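(* Let $n\ge 2$ and $s$ be integers, and let $S\subseteq\mathcal{S}_n$ be a set of permutations that is not transitive and has covering radius $\operatorname{crad}(S)\le n-s$. Then $f(n-1,s)\le |S|$.
   Context: $\mathcal{S}_n$ denotes the set of permutations of $[n]=\{1,\dots,n\}$, with the Hamming distance $d_H(\rho,\sigma)=|\{i\in[n]:\rho(i)\ne\sigma(i)\}|$. For $S\subseteq\mathcal{S}_n$, the covering radius $\operatorname{crad}(S)$ is the least $r$ such that for every $\rho\in\mathcal{S}_n$ there is $\sigma\in S$ with $d_H(\rho,\sigma)\le r$. $f(n,s)$ denotes the minimum size of a subset $S\subseteq\mathcal{S}_n$ with $\operatorname{crad}(S)\le n-s$, i.e. such that every $\rho\in\mathcal{S}_n$ is at Hamming distance at most $n-s$ from some $\sigma\in S$. A set $S\subseteq\mathcal{S}_n$ is transitive if for all $x,y\in[n]$ there exists $\sigma\in S$ with $\sigma(x)=y$. *)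

theory Defs
  imports "HOL-Combinatorics.Permutations" "HOL-Library.Extended_Real"
begin

definition perms :: "nat \<Rightarrow> (nat \<Rightarrow> nat) set" where
  "perms n = {\<rho>. \<rho> permutes {1..n}}"

definition hamming_dist :: "nat \<Rightarrow> (nat \<Rightarrow> nat) \<Rightarrow> (nat \<Rightarrow> nat) \<Rightarrow> nat" where
  "hamming_dist n \<rho> \<sigma> = card {i \<in> {1..n}. \<rho> i \<noteq> \<sigma> i}"

(* Inf of a nonempty set of extended naturals is its least element; Inf of the empty
   set is infinity, so the empty set of permutations has infinite covering radius. *)
definition crad :: "nat \<Rightarrow> (nat \<Rightarrow> nat) set \<Rightarrow> enat" where
  "crad n S = Inf {enat r | r. \<forall>\<rho>\<in>perms n. \<exists>\<sigma>\<in>S. hamming_dist n \<rho> \<sigma> \<le> r}"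

(* The parameter s is an arbitrary integer, so n - s may be negative; the bound on the
   covering radius is therefore compared in ereal. If no S qualifies (s > n), the value
   is infinity. *)
definition cover_num :: "nat \<Rightarrow> int \<Rightarrow> enat" where
  "cover_num n s = Inf {enat (card S) | S. S \<subseteq> perms n \<and>
     ereal_of_enat (crad n S) \<le> ereal (real_of_int (int n - s))}"

definition transitive_set :: "nat \<Rightarrow> (nat \<Rightarrow> nat) set \<Rightarrow> bool" where
  "transitive_set n S \<longleftrightarrow> (\<forall>x\<in>{1..n}. \<forall>y\<in>{1..n}. \<exists>\<sigma>\<in>S. \<sigma> x = y)"

end

(* Choose x, y such that no member of S maps x to y. After relabelling both the domain and the
   codomain, x = y = n. A permutation of {1..n-1}, regarded as fixing n, disagrees at n with every
   member of S, and swapping the values n and \<sigma>(n) of \<sigma> turns \<sigma> into a permutation of {1..n-1}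
   without destroying any agreement, so each distance drops by at least one. *)
theory Submission imports Defs begin

text \<open>An infimum of extended naturals is attained as soon as it is finite, so the radius
  itself is a covering distance. The integer \<open>k\<close> may be negative; then both sides
  fail.\<close>

lemma crad_le_iff:
  "ereal_of_enat (crad n S) \<le> ereal (real_of_int k) \<longleftrightarrow>
     (\<forall>\<rho>\<in>perms n. \<exists>\<sigma>\<in>S. int (hamming_dist n \<rho> \<sigma>) \<le> k)"
  (is "?L \<longleftrightarrow> ?R")
proof
  let ?A = "{enat r | r. \<forall>\<rho>\<in>perms n. \<exists>\<sigma>\<in>S. hamming_dist n \<rho> \<sigma> \<le> r}"
  assume L: ?L
  then have "crad n S \<noteq> \<infinity>" by (metis ereal_of_enat_simps(2) PInfty_neq_ereal(1) ereal_infty_less_eq(1))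
  then have ne: "?A \<noteq> {}"
    unfolding crad_def Inf_enat_def by (rule contrapos_nn) (rule if_P)
  then obtain a where "a \<in> ?A" by blast
  then have "(LEAST a. a \<in> ?A) \<in> ?A" by (rule LeastI)
  then have "Inf ?A \<in> ?A" using ne by (simp only: Inf_enat_def if_False)
  then obtain r where r: "crad n S = enat r"
    and cover: "\<forall>\<rho>\<in>perms n. \<exists>\<sigma>\<in>S. hamming_dist n \<rho> \<sigma> \<le> r"
    unfolding crad_def by blast
  from L r have "int r \<le> k" by simp
  with cover show ?R by (meson of_nat_le_iff order_trans)
next
  assume R: ?R
  \<comment> \<open>Since \<open>perms n\<close> is nonempty, some distance is bounded by
    \<open>k\<close>; hence \<open>k\<close> is nonnegative and passing to \<open>nat k\<close>
    loses nothing.\<close>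
  have "id \<in> perms n" by (simp add: perms_def)
  with R have "0 \<le> k" by (meson of_nat_0_le_iff order_trans)
  then have "\<forall>\<rho>\<in>perms n. \<exists>\<sigma>\<in>S. hamming_dist n \<rho> \<sigma> \<le> nat k"
    using R by (simp only: le_nat_iff)
  then have "crad n S \<le> enat (nat k)" unfolding crad_def by (intro Inf_lower) blast
  then have "ereal_of_enat (crad n S) \<le> ereal_of_enat (enat (nat k))"
    by (simp only: ereal_of_enat_le_iff)
  with \<open>0 \<le> k\<close> show ?L by simp
qed

text \<open>An injective \<open>q\<close> preserves disagreement of values, and \<open>p\<close>
  maps the positions of disagreement of the composites bijectively onto those of \<rho> and
  \<sigma>.\<close>

lemma hamming_dist_comp:
  assumes p: "p permutes {1..n}" and q: "inj q"
  shows "hamming_dist n (q \<circ> \<rho> \<circ> p) (q \<circ> \<sigma> \<circ> p) = hamming_dist n \<rho> \<sigma>"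
proof -
  have "p ` {i \<in> {1..n}. \<rho> (p i) \<noteq> \<sigma> (p i)} = {i \<in> {1..n}. \<rho> i \<noteq> \<sigma> i}"
  proof (intro equalityI subsetI)
    fix j assume j: "j \<in> {i \<in> {1..n}. \<rho> i \<noteq> \<sigma> i}"
    then obtain i where "i \<in> {1..n}" "j = p i" using permutes_image[OF p] by blast
    with j show "j \<in> p ` {i \<in> {1..n}. \<rho> (p i) \<noteq> \<sigma> (p i)}" by blast
  qed (use permutes_in_image[OF p] in auto)
  then have "card {i \<in> {1..n}. \<rho> i \<noteq> \<sigma> i} = card {i \<in> {1..n}. \<rho> (p i) \<noteq> \<sigma> (p i)}"
    using card_image[OF permutes_inj_on[OF p], of "{i \<in> {1..n}. \<rho> (p i) \<noteq> \<sigma> (p i)}"] by simp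
  then show ?thesis using q by (simp add: hamming_dist_def inj_eq)
qed

text \<open>The transposition acts on values, so \<tau> changes at most at \<open>n\<close> and at
  the position that it sends to \<open>n\<close>.\<close>

definition fix_last :: "nat \<Rightarrow> (nat \<Rightarrow> nat) \<Rightarrow> nat \<Rightarrow> nat" where
  "fix_last n \<tau> = transpose n (\<tau> n) \<circ> \<tau>"

lemma fix_last_permutes:
  assumes "\<tau> permutes {1..Suc m}"
  shows "fix_last (Suc m) \<tau> permutes {1..m}"
proof -
  have "\<tau> (Suc m) \<in> {1..Suc m}" using permutes_in_image[OF assms] by simp
  then have "fix_last (Suc m) \<tau> permutes {1..Suc m}"
    unfolding fix_last_def by (intro permutes_compose assms permutes_swap_id) auto
  then show ?thesis
    by (rule permutes_superset) (auto simp: fix_last_def le_Suc_eq)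
qed

text \<open>Every disagreement on \<open>{1..m}\<close> after the swap was already one before it,
  and \<open>Suc m\<close> is an additional disagreement because \<rho> fixes it and \<tau> does
  not.\<close>

lemma hamming_dist_fix_last:
  assumes \<rho>: "\<rho> permutes {1..m}" and \<tau>: "\<tau> permutes {1..Suc m}"
    and neq: "\<tau> (Suc m) \<noteq> Suc m"
  shows "Suc (hamming_dist m \<rho> (fix_last (Suc m) \<tau>)) \<le> hamming_dist (Suc m) \<rho> \<tau>"
proof -
  let ?D = "{i \<in> {1..m}. \<rho> i \<noteq> fix_last (Suc m) \<tau> i}"
  have "\<rho> (Suc m) = Suc m" using permutes_not_in[OF \<rho>] by simp
  moreover have "\<rho> i \<noteq> \<tau> i" if i: "i \<in> {1..m}" and d: "\<rho> i \<noteq> fix_last (Suc m) \<tau> i" for i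
  proof
    assume eq: "\<rho> i = \<tau> i"
    \<comment> \<open>The common value is neither of the two swapped values: it is at most
      \<open>m\<close>, and injectivity separates it from \<open>\<tau> (Suc m)\<close>. So the swap
      leaves it alone.\<close>
    have "\<rho> i \<in> {1..m}" using permutes_in_image[OF \<rho>] i by simp
    then have "\<tau> i \<noteq> Suc m" using eq by auto
    moreover have "\<tau> i \<noteq> \<tau> (Suc m)" using i injD[OF permutes_inj[OF \<tau>], of i "Suc m"] by auto
    ultimately show False using d eq by (simp add: fix_last_def)
  qed
  ultimately have "insert (Suc m) ?D \<subseteq> {i \<in> {1..Suc m}. \<rho> i \<noteq> \<tau> i}" using neq by auto
  then have "card (insert (Suc m) ?D) \<le> hamming_dist (Suc m) \<rho> \<tau>"
    unfolding hamming_dist_def by (intro card_mono) auto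
  then show ?thesis by (simp add: hamming_dist_def)
qed

theorem mainTheorem1:
  fixes n :: nat and s :: int and S :: "(nat \<Rightarrow> nat) set"
  assumes "n \<ge> 2"
    and "S \<subseteq> perms n"
    and "\<not> transitive_set n S"
    and "ereal_of_enat (crad n S) \<le> ereal (real_of_int (int n - s))"
  shows "cover_num (n - 1) s \<le> enat (card S)"
proof -
  obtain m where n: "n = Suc m" using assms(1) by (cases n) auto
  obtain x y where x: "x \<in> {1..n}" and y: "y \<in> {1..n}" and xy: "\<forall>\<sigma>\<in>S. \<sigma> x \<noteq> y"
    using assms(3) unfolding transitive_set_def by blast
  have cover: "\<forall>\<rho>\<in>perms n. \<exists>\<sigma>\<in>S. int (hamming_dist n \<rho> \<sigma>) \<le> int n - s"
    using assms(4) by (simp only: crad_le_iff)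
  let ?p = "transpose x n" and ?q = "transpose y n"
  \<comment> \<open>Built from transpositions, this is an involution, and
    \<open>relabel \<sigma>\<close> fixes \<open>n\<close> exactly when \<sigma> maps
    \<open>x\<close> to \<open>y\<close>.\<close>
  define relabel where "relabel \<sigma> = ?q \<circ> \<sigma> \<circ> ?p" for \<sigma> :: "nat \<Rightarrow> nat"
  have p: "?p permutes {1..n}" and q: "?q permutes {1..n}"
    using x y n by (auto intro: permutes_swap_id)
  have relabel_permutes: "relabel \<sigma> permutes {1..n}" if "\<sigma> permutes {1..n}" for \<sigma>
    unfolding relabel_def using that p q by (intro permutes_compose)
  have relabel_relabel: "relabel (relabel \<sigma>) = \<sigma>" for \<sigma>
    by (simp add: relabel_def fun_eq_iff)
  have relabel_dist: "hamming_dist n (relabel \<rho>) (relabel \<sigma>) = hamming_dist n \<rho> \<sigma>" for \<rho> \<sigma>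
    unfolding relabel_def by (intro hamming_dist_comp p) simp
  define T where "T = (\<lambda>\<sigma>. fix_last n (relabel \<sigma>)) ` S"
  have "T \<subseteq> perms m"
    using assms(2) relabel_permutes fix_last_permutes n unfolding T_def perms_def by blast
  moreover have "\<exists>\<tau>\<in>T. int (hamming_dist m \<rho> \<tau>) \<le> int m - s" if \<rho>: "\<rho> \<in> perms m" for \<rho>
  proof -
    have "\<rho> permutes {1..n}"
      using \<rho> n by (auto simp: perms_def intro: permutes_subset)
    \<comment> \<open>The covering hypothesis concerns \<open>S\<close>, not its relabelled copy, so
      it is applied to \<open>relabel \<rho>\<close>; the involution then moves the relabelling over
      to \<sigma>.\<close>
    then have "relabel \<rho> \<in> perms n" using relabel_permutes by (simp add: perms_def)
    then obtain \<sigma> where \<sigma>: "\<sigma> \<in> S" and d: "int (hamming_dist n (relabel \<rho>) \<sigma>) \<le> int n - s"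
      using cover by blast
    have "\<sigma> permutes {1..n}" using \<sigma> assms(2) by (auto simp: perms_def)
    moreover have "relabel \<sigma> n \<noteq> n"
      using xy \<sigma> by (auto simp: relabel_def transpose_eq_iff)
    ultimately have "Suc (hamming_dist m \<rho> (fix_last n (relabel \<sigma>))) \<le> hamming_dist n \<rho> (relabel \<sigma>)"
      using hamming_dist_fix_last[of \<rho> m "relabel \<sigma>"] relabel_permutes \<rho> n
      by (simp add: perms_def)
    also have "\<dots> = hamming_dist n (relabel \<rho>) \<sigma>"
      using relabel_dist[of \<rho> "relabel \<sigma>"] by (simp add: relabel_relabel)
    \<comment> \<open>The unit of distance gained at position \<open>n\<close> is exactly the
      difference between \<open>int n - s\<close> and \<open>int m - s\<close>.\<close>
    finally have "int (hamming_dist m \<rho> (fix_last n (relabel \<sigma>))) \<le> int m - s"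
      using d n by simp
    then show ?thesis using \<sigma> by (auto simp: T_def)
  qed
  then have "ereal_of_enat (crad m T) \<le> ereal (real_of_int (int m - s))"
    unfolding crad_le_iff by blast
  ultimately have "cover_num m s \<le> enat (card T)"
    unfolding cover_num_def by (intro Inf_lower) blast
  \<comment> \<open>Finiteness matters because \<open>card\<close> is 0 on infinite sets; the map
    from \<open>S\<close> onto \<open>T\<close> may identify elements, which only helps.\<close>
  moreover have "finite S"
    using assms(2) by (rule finite_subset) (simp add: perms_def finite_permutations)
  then have "card T \<le> card S" unfolding T_def by (rule card_image_le)
  ultimately show ?thesis using n by (simp add: order_trans)
qed

end
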